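(* Let $K$ be a number field and let $L=K\mathbf e_1+K\mathbf e_2$. Then every prime element $\pi\in\mathcal{O}_K$ becomes semiprime in $\mathcal{O}_L$: one has $$\pi=(\pi\mathbf e_1+\mathbf e_2)(\mathbf e_1+\pi\mathbf e_2),$$ and each of the two factors is prime in $\mathcal{O}_L$.
   Context: The bicomplex numbers are the commutative 4-dimensional real algebra $\mathbb{B}=\{x+y\mathbf i+z\mathbf j+t\mathbf k: x,y,z,t\in\mathbb{R}\}$ with $\mathbf i^2=\mathbf k^2=-1$, $\mathbf j^2=1$, $\mathbf i\mathbf j=\mathbf j\mathbf i=\mathbf k$; $\mathbb{C}$ is identified with $\{x+y\mathbf i\}$. Put $\mathbf e_1=\frac{1+\mathbf j}{2}$, $\mathbf e_2=\frac{1-\mathbf j}{2}$; every bicomplex number is uniquely $\gamma_1\mathbf e_1+\gamma_2\mathbf e_2$ with $\gamma_1,\gamma_2\in\mathbb{C}$, and operations are componentwise. Number fields are subfields of $\mathbb{C}$ of finite degree over $\mathbb{Q}$, and $K\mathbf e_1+K\mathbf e_2=\{\gamma_1\mathbf e_1+\gamma_2\mathbf e_2:\gamma_1,\gamma_2\in K\}\subset\mathbb{B}$. $\mathcal{O}_L$ is the ring of elements of $L$ that are roots of a monic polynomial over $\mathbb{Z}$. An element $\pi$ of a commutative ring is prime if it is non-zero, non-unit and the ideal $(\pi)$ is prime. Semiprime means: product of two prime elements. *)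

theory Defs
  imports
    Complex_Main
    "HOL-Computational_Algebra.Polynomial"
    "HOL-Algebra.Embedded_Algebras"
    "HOL-Algebra.Ideal"
begin

section \<open>The algebra of bicomplex numbers\<close>

text \<open>
  \<open>Bicomplex x y z t\<close> stands for \<open>x + y i + z j + t k\<close>. The multiplication is the bilinear one
  determined by \<open>i\<^sup>2 = k\<^sup>2 = -1\<close>, \<open>j\<^sup>2 = 1\<close>, \<open>i j = j i = k\<close>; hence \<open>i k = -j\<close> and \<open>j k = i\<close>.
\<close>

codatatype bicomplex = Bicomplex (bc1: real) (bci: real) (bcj: real) (bck: real)

lemma bicomplex_eq_iff:
  "a = b \<longleftrightarrow> bc1 a = bc1 b \<and> bci a = bci b \<and> bcj a = bcj b \<and> bck a = bck b"
  by (auto intro: bicomplex.expand)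

instantiation bicomplex :: comm_ring_1
begin

primcorec zero_bicomplex where
  "bc1 0 = 0"
| "bci 0 = 0"
| "bcj 0 = 0"
| "bck 0 = 0"

primcorec one_bicomplex where
  "bc1 1 = 1"
| "bci 1 = 0"
| "bcj 1 = 0"
| "bck 1 = 0"

primcorec plus_bicomplex where
  "bc1 (a + b) = bc1 a + bc1 b"
| "bci (a + b) = bci a + bci b"
| "bcj (a + b) = bcj a + bcj b"
| "bck (a + b) = bck a + bck b"

primcorec uminus_bicomplex where
  "bc1 (- a) = - bc1 a"
| "bci (- a) = - bci a"
| "bcj (- a) = - bcj a"
| "bck (- a) = - bck a"

primcorec minus_bicomplex where
  "bc1 (a - b) = bc1 a - bc1 b"
| "bci (a - b) = bci a - bci b"
| "bcj (a - b) = bcj a - bcj b"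
| "bck (a - b) = bck a - bck b"

primcorec times_bicomplex where
  "bc1 (a * b) = bc1 a * bc1 b - bci a * bci b + bcj a * bcj b - bck a * bck b"
| "bci (a * b) = bc1 a * bci b + bci a * bc1 b + bcj a * bck b + bck a * bcj b"
| "bcj (a * b) = bc1 a * bcj b + bcj a * bc1 b - bci a * bck b - bck a * bci b"
| "bck (a * b) = bc1 a * bck b + bck a * bc1 b + bci a * bcj b + bcj a * bci b"

instance
  by standard (simp_all add: bicomplex_eq_iff algebra_simps)

end

instantiation bicomplex :: real_algebra_1
begin

primcorec scaleR_bicomplex where
  "bc1 (r *\<^sub>R a) = r * bc1 a"
| "bci (r *\<^sub>R a) = r * bci a"
| "bcj (r *\<^sub>R a) = r * bcj a"
| "bck (r *\<^sub>R a) = r * bck a"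

instance
  by standard (simp_all add: bicomplex_eq_iff algebra_simps)

end

definition bc_i :: bicomplex where "bc_i = Bicomplex 0 1 0 0"
definition bc_j :: bicomplex where "bc_j = Bicomplex 0 0 1 0"
definition bc_k :: bicomplex where "bc_k = Bicomplex 0 0 0 1"

lemma bicomplex_basis:
  "Bicomplex x y z t = x *\<^sub>R 1 + y *\<^sub>R bc_i + z *\<^sub>R bc_j + t *\<^sub>R bc_k"
  by (simp add: bicomplex_eq_iff bc_i_def bc_j_def bc_k_def)

lemma bicomplex_units_mult:
  "bc_i * bc_i = -1" "bc_j * bc_j = 1" "bc_k * bc_k = -1" "bc_i * bc_j = bc_k" "bc_j * bc_i = bc_k"
  by (simp_all add: bicomplex_eq_iff bc_i_def bc_j_def bc_k_def)

definition bc_of_complex :: "complex \<Rightarrow> bicomplex" where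
  "bc_of_complex w = Re w *\<^sub>R 1 + Im w *\<^sub>R bc_i"

definition bc_e1 :: bicomplex where "bc_e1 = (1 / 2) *\<^sub>R (1 + bc_j)"
definition bc_e2 :: bicomplex where "bc_e2 = (1 / 2) *\<^sub>R (1 - bc_j)"

lemma bc_of_complex_hom:
  "bc_of_complex 1 = 1"
  "bc_of_complex (v + w) = bc_of_complex v + bc_of_complex w"
  "bc_of_complex (v * w) = bc_of_complex v * bc_of_complex w"
  by (simp_all add: bicomplex_eq_iff bc_of_complex_def bc_i_def)

lemma bc_idempotents:
  "bc_e1 * bc_e1 = bc_e1" "bc_e2 * bc_e2 = bc_e2" "bc_e1 * bc_e2 = 0" "bc_e1 + bc_e2 = 1"
  by (simp_all add: bicomplex_eq_iff bc_e1_def bc_e2_def bc_j_def)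

lemma bc_idempotent_coordinates:
  "a = bc_of_complex v * bc_e1 + bc_of_complex w * bc_e2 \<longleftrightarrow>
     v = Complex (bc1 a + bcj a) (bci a + bck a) \<and> w = Complex (bc1 a - bcj a) (bci a - bck a)"
  unfolding bicomplex_eq_iff complex_eq_iff
  by (simp add: bc_of_complex_def bc_e1_def bc_e2_def bc_i_def bc_j_def) argo

lemma bc_idempotent_representation:
  "\<exists>!(v, w). a = bc_of_complex v * bc_e1 + bc_of_complex w * bc_e2"
  by (auto simp: bc_idempotent_coordinates)

definition bc_extension :: "complex set \<Rightarrow> bicomplex set" where
  "bc_extension K = {bc_of_complex v * bc_e1 + bc_of_complex w * bc_e2 | v w. v \<in> K \<and> w \<in> K}"


section \<open>Number fields and rings of integers\<close>

text \<open>The ring structure that a subset \<open>S\<close> inherits from its ambient type.\<close>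

definition ring_on :: "'a::comm_ring_1 set \<Rightarrow> 'a ring" where
  "ring_on S = \<lparr>carrier = S, mult = (*), one = 1, zero = 0, add = (+)\<rparr>"

lemma cring_ring_on_UNIV: "cring (ring_on (UNIV :: 'a::comm_ring_1 set))"
proof (rule cringI)
  show "abelian_group (ring_on (UNIV :: 'a set))"
    by (rule abelian_groupI) (auto simp: ring_on_def algebra_simps intro: exI[of _ "- _"])
  show "comm_monoid (ring_on (UNIV :: 'a set))"
    by (rule comm_monoidI) (auto simp: ring_on_def algebra_simps)
qed (auto simp: ring_on_def algebra_simps)

definition number_field :: "complex set \<Rightarrow> bool" where
  "number_field K \<longleftrightarrow>
     subfield K (ring_on UNIV) \<and> ring.finite_dimension (ring_on UNIV) \<rat> K"

text \<open>
  The library predicate \<^const>\<open>algebraic_int\<close> is restricted to fields, and \<^typ>\<open>bicomplex\<close> has zero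
  divisors; on \<^typ>\<open>complex\<close> the carrier below is the usual one.
\<close>

definition ring_of_integers :: "'a::comm_ring_1 set \<Rightarrow> 'a ring" where
  "ring_of_integers L =
     ring_on {a \<in> L. \<exists>p :: int poly. lead_coeff p = 1 \<and> poly (map_poly of_int p) a = 0}"

lemma carrier_ring_of_integers_complex:
  "carrier (ring_of_integers K) = {a \<in> K. algebraic_int (a :: complex)}"
  by (auto simp: ring_of_integers_def ring_on_def algebraic_int_altdef_ipoly)

text \<open>
  Primality is that of the principal ideal; \<open>ring_prime\<close> in HOL-Algebra is phrased by divisibility.
\<close>

definition prime_element :: "('a, 'b) ring_scheme \<Rightarrow> 'a \<Rightarrow> bool" where
  "prime_element R a \<longleftrightarrow>
     a \<in> carrier R \<and> a \<noteq> \<zero>\<^bsub>R\<^esub> \<and> a \<notin> Units R \<and> primeideal (PIdl\<^bsub>R\<^esub> a) R"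

definition semiprime :: "('a, 'b) ring_scheme \<Rightarrow> 'a \<Rightarrow> bool" where
  "semiprime R a \<longleftrightarrow> (\<exists>p q. prime_element R p \<and> prime_element R q \<and> a = p \<otimes>\<^bsub>R\<^esub> q)"

end

theory Submission
  imports Defs "HOL-Algebra.QuotRing"
begin

text \<open>
  Via the two idempotent coordinates, the bicomplex numbers are the ring product \<open>\<complex> \<times> \<complex>\<close>, and \<open>bc_extension A\<close> is
  \<open>A \<times> A\<close>. A monic integer polynomial annihilates a bicomplex number iff it annihilates both
  coordinates; as the product of monic polynomials is monic, \<open>\<O>\<^sub>L = \<O>\<^sub>K \<times> \<O>\<^sub>K\<close>
  (\<open>ring_of_integers_bc_extension\<close>).

  In a product ring \<open>A \<times> A\<close> the element \<open>(\<pi>, 1)\<close> generates the ideal \<open>(\<pi>) \<times> A\<close>, which is the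
  preimage of \<open>(\<pi>)\<close> under the first projection. Preimages of prime ideals under ring homomorphisms
  are prime, so \<open>(\<pi>, 1)\<close> is prime when \<open>\<pi>\<close> is (\<open>prime_element_if_ideal_is_preimage\<close>);
  likewise \<open>(1, \<pi>)\<close> with the second projection. Their product is \<open>(\<pi>, \<pi>)\<close>, the image of \<open>\<pi>\<close>.
\<close>


section \<open>Idempotent coordinates\<close>

definition bc_fst :: "bicomplex \<Rightarrow> complex" where
  "bc_fst a = Complex (bc1 a + bcj a) (bci a + bck a)"

definition bc_snd :: "bicomplex \<Rightarrow> complex" where
  "bc_snd a = Complex (bc1 a - bcj a) (bci a - bck a)"

lemma bc_coords_eq_iff: "a = b \<longleftrightarrow> bc_fst a = bc_fst b \<and> bc_snd a = bc_snd b"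
  unfolding bicomplex_eq_iff bc_fst_def bc_snd_def by simp argo

lemma bc_fst_simps [simp]:
  "bc_fst 0 = 0" "bc_fst 1 = 1" "bc_fst (- a) = - bc_fst a"
  "bc_fst (a + b) = bc_fst a + bc_fst b" "bc_fst (a * b) = bc_fst a * bc_fst b"
  "bc_fst (bc_of_complex v) = v" "bc_fst bc_e1 = 1" "bc_fst bc_e2 = 0"
  by (simp_all add: bc_fst_def complex_eq_iff bc_of_complex_def bc_i_def bc_e1_def bc_e2_def
      bc_j_def algebra_simps)

lemma bc_snd_simps [simp]:
  "bc_snd 0 = 0" "bc_snd 1 = 1" "bc_snd (- a) = - bc_snd a"
  "bc_snd (a + b) = bc_snd a + bc_snd b" "bc_snd (a * b) = bc_snd a * bc_snd b"
  "bc_snd (bc_of_complex v) = v" "bc_snd bc_e1 = 0" "bc_snd bc_e2 = 1"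
  by (simp_all add: bc_snd_def complex_eq_iff bc_of_complex_def bc_i_def bc_e1_def bc_e2_def
      bc_j_def algebra_simps)

lemma mem_bc_extension_iff: "a \<in> bc_extension A \<longleftrightarrow> bc_fst a \<in> A \<and> bc_snd a \<in> A"
proof
  assume "bc_fst a \<in> A \<and> bc_snd a \<in> A"
  moreover have "a = bc_of_complex (bc_fst a) * bc_e1 + bc_of_complex (bc_snd a) * bc_e2"
    by (simp add: bc_coords_eq_iff)
  ultimately show "a \<in> bc_extension A"
    unfolding bc_extension_def by blast
qed (auto simp: bc_extension_def)


section \<open>Integrality in coordinates\<close>

lemma poly_of_int_mult:
  "poly (map_poly of_int (p * q)) (x :: 'a::comm_ring_1) =
     poly (map_poly of_int p) x * poly (map_poly of_int q) x"
proof -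
  have "map_poly of_int (p * q) = (map_poly of_int p * map_poly of_int q :: 'a poly)"
    by (rule poly_eqI) (simp add: coeff_map_poly coeff_mult)
  then show ?thesis by simp
qed

lemma bc_fst_poly: "bc_fst (poly (map_poly of_int p) a) = poly (map_poly of_int p) (bc_fst a)"
proof -
  have "bc_fst (of_int n) = of_int n" for n
    by (induction n rule: int_induct[of _ 0]) (simp_all flip: add_uminus_conv_diff)
  then show ?thesis
    by (induction p) (simp_all add: map_poly_pCons)
qed

lemma bc_snd_poly: "bc_snd (poly (map_poly of_int p) a) = poly (map_poly of_int p) (bc_snd a)"
proof -
  have "bc_snd (of_int n) = of_int n" for n
    by (induction n rule: int_induct[of _ 0]) (simp_all flip: add_uminus_conv_diff)
  then show ?thesis
    by (induction p) (simp_all add: map_poly_pCons)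
qed

text \<open>
  If monic \<open>p\<close> and \<open>q\<close> annihilate the first and the second coordinate, then the monic polynomial
  \<open>p q\<close> annihilates both.
\<close>

lemma ring_of_integers_bc_extension:
  "ring_of_integers (bc_extension K) = ring_on (bc_extension (carrier (ring_of_integers K)))"
proof -
  let ?int = "\<lambda>a. \<exists>p :: int poly. lead_coeff p = 1 \<and> poly (map_poly of_int p) a = 0"
  have "?int a \<longleftrightarrow> ?int (bc_fst a) \<and> ?int (bc_snd a)" for a
  proof
    assume "?int a"
    then show "?int (bc_fst a) \<and> ?int (bc_snd a)"
      by (metis bc_fst_poly bc_fst_simps(1) bc_snd_poly bc_snd_simps(1))
  next
    assume "?int (bc_fst a) \<and> ?int (bc_snd a)"
    then obtain p q :: "int poly"
      where "lead_coeff p = 1" "poly (map_poly of_int p) (bc_fst a) = 0"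
        and "lead_coeff q = 1" "poly (map_poly of_int q) (bc_snd a) = 0"
      by blast
    then have "lead_coeff (p * q) = 1" "poly (map_poly of_int (p * q)) a = 0"
      by (simp_all add: lead_coeff_mult bc_coords_eq_iff bc_fst_poly bc_snd_poly poly_of_int_mult
          del: coeff_mult_degree_sum)
    then show "?int a" by blast
  qed
  then have "{a \<in> bc_extension K. ?int a} = bc_extension {v \<in> K. ?int v}"
    by (auto simp: mem_bc_extension_iff)
  then show ?thesis
    by (simp add: ring_of_integers_def ring_on_def)
qed


section \<open>Rings carried by subsets\<close>

lemma ring_on_simps [simp]:
  "carrier (ring_on A) = A" "x \<otimes>\<^bsub>ring_on A\<^esub> y = x * y" "x \<oplus>\<^bsub>ring_on A\<^esub> y = x + y"
  "\<one>\<^bsub>ring_on A\<^esub> = 1" "\<zero>\<^bsub>ring_on A\<^esub> = 0"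
  by (simp_all add: ring_on_def)

lemma cring_ring_on_iff:
  "cring (ring_on A) \<longleftrightarrow> 0 \<in> A \<and> 1 \<in> A \<and> (\<forall>x\<in>A. - x \<in> A) \<and>
     (\<forall>x\<in>A. \<forall>y\<in>A. x + y \<in> A) \<and> (\<forall>x\<in>A. \<forall>y\<in>A. x * y \<in> A)"
  (is "_ \<longleftrightarrow> ?closed")
proof
  assume "cring (ring_on A)"
  then interpret cring "ring_on A" .
  have "- x \<in> A" if "x \<in> A" for x
  proof -
    have "\<ominus>\<^bsub>ring_on A\<^esub> x \<in> A" "x + \<ominus>\<^bsub>ring_on A\<^esub> x = 0"
      using that a_inv_closed[of x] r_neg[of x] by simp_all
    then show ?thesis by (metis group_add_class.minus_unique)
  qed
  then show ?closed
    using zero_closed one_closed a_closed m_closed by simp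
next
  assume closed: ?closed
  show "cring (ring_on A)"
  proof (rule cringI)
    show "abelian_group (ring_on A)"
      using closed by (intro abelian_groupI) (auto simp: algebra_simps intro!: bexI[of _ "- _"])
    show "comm_monoid (ring_on A)"
      using closed by (intro comm_monoidI) (auto simp: algebra_simps)
  qed (auto simp: algebra_simps)
qed

lemma cring_bc_extension:
  assumes "cring (ring_on A)"
  shows "cring (ring_on (bc_extension A))"
  using assms unfolding cring_ring_on_iff by (simp add: mem_bc_extension_iff)


section \<open>Prime elements of the product ring\<close>

lemma prime_element_if_ideal_is_preimage:
  assumes "ring_hom_cring R S h" and "p \<in> carrier R"
    and preimage: "PIdl\<^bsub>R\<^esub> p = {r \<in> carrier R. h r \<in> PIdl\<^bsub>S\<^esub> h p}"
    and prime: "prime_element S (h p)"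
  shows "prime_element R p"
proof -
  interpret ring_hom_cring R S h by fact
  have "p \<notin> Units R"
  proof
    assume "p \<in> Units R"
    then obtain q where "q \<in> carrier R" "q \<otimes>\<^bsub>R\<^esub> p = \<one>\<^bsub>R\<^esub>" "p \<otimes>\<^bsub>R\<^esub> q = \<one>\<^bsub>R\<^esub>"
      unfolding Units_def by blast
    then have "h q \<otimes>\<^bsub>S\<^esub> h p = \<one>\<^bsub>S\<^esub>" "h p \<otimes>\<^bsub>S\<^esub> h q = \<one>\<^bsub>S\<^esub>"
      using \<open>p \<in> carrier R\<close> by (metis hom_mult hom_one)+
    then have "h p \<in> Units S"
      using \<open>p \<in> carrier R\<close> \<open>q \<in> carrier R\<close> unfolding Units_def by blast
    with prime show False by (simp add: prime_element_def)
  qed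
  moreover have "primeideal (PIdl\<^bsub>R\<^esub> p) R"
    unfolding preimage using prime
    by (intro ring.primeideal_vimage R.is_cring) (simp add: prime_element_def)
  ultimately show ?thesis
    using \<open>p \<in> carrier R\<close> prime by (auto simp: prime_element_def)
qed

text \<open>
  Divisibility by \<open>(\<pi>, 1)\<close> is a condition on the first coordinate only, since every second
  coordinate is a multiple of \<open>1\<close>.
\<close>

lemma prime_element_bc_extension_left:
  assumes prime: "prime_element (ring_on A) \<pi>"
  shows "prime_element (ring_on (bc_extension A)) (bc_of_complex \<pi> * bc_e1 + bc_e2)"
    (is "prime_element ?R ?p")
proof (rule prime_element_if_ideal_is_preimage)
  have A: "cring (ring_on A)" and "\<pi> \<in> A"
    using prime by (auto simp: prime_element_def dest: primeideal.axioms(2))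
  show "ring_hom_cring ?R (ring_on A) bc_fst"
    using A cring_bc_extension[OF A]
    by (intro RingHom.ring_hom_cringI ring_hom_ringI)
      (auto simp: mem_bc_extension_iff intro: cring.axioms(1))
  show "?p \<in> carrier ?R"
    using A \<open>\<pi> \<in> A\<close> by (auto simp: mem_bc_extension_iff cring_ring_on_iff)
  show "PIdl\<^bsub>?R\<^esub> ?p = {r \<in> carrier ?R. bc_fst r \<in> PIdl\<^bsub>ring_on A\<^esub> (bc_fst ?p)}"
  proof (intro equalityI subsetI)
    fix r assume "r \<in> PIdl\<^bsub>?R\<^esub> ?p"
    then show "r \<in> {r \<in> carrier ?R. bc_fst r \<in> PIdl\<^bsub>ring_on A\<^esub> (bc_fst ?p)}"
      using A \<open>\<pi> \<in> A\<close> by (auto simp: cgenideal_def mem_bc_extension_iff cring_ring_on_iff)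
  next
    fix r assume "r \<in> {r \<in> carrier ?R. bc_fst r \<in> PIdl\<^bsub>ring_on A\<^esub> (bc_fst ?p)}"
    then obtain x where "x \<in> A" "bc_fst r = x * \<pi>" "bc_snd r \<in> A"
      by (auto simp: cgenideal_def mem_bc_extension_iff)
    then show "r \<in> PIdl\<^bsub>?R\<^esub> ?p"
      unfolding cgenideal_def
      by (auto simp: mem_bc_extension_iff bc_coords_eq_iff
          intro!: exI[of _ "bc_of_complex x * bc_e1 + bc_of_complex (bc_snd r) * bc_e2"])
  qed
  show "prime_element (ring_on A) (bc_fst ?p)"
    using prime by simp
qed

lemma prime_element_bc_extension_right:
  assumes prime: "prime_element (ring_on A) \<pi>"
  shows "prime_element (ring_on (bc_extension A)) (bc_e1 + bc_of_complex \<pi> * bc_e2)"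
    (is "prime_element ?R ?p")
proof (rule prime_element_if_ideal_is_preimage)
  have A: "cring (ring_on A)" and "\<pi> \<in> A"
    using prime by (auto simp: prime_element_def dest: primeideal.axioms(2))
  show "ring_hom_cring ?R (ring_on A) bc_snd"
    using A cring_bc_extension[OF A]
    by (intro RingHom.ring_hom_cringI ring_hom_ringI)
      (auto simp: mem_bc_extension_iff intro: cring.axioms(1))
  show "?p \<in> carrier ?R"
    using A \<open>\<pi> \<in> A\<close> by (auto simp: mem_bc_extension_iff cring_ring_on_iff)
  show "PIdl\<^bsub>?R\<^esub> ?p = {r \<in> carrier ?R. bc_snd r \<in> PIdl\<^bsub>ring_on A\<^esub> (bc_snd ?p)}"
  proof (intro equalityI subsetI)
    fix r assume "r \<in> PIdl\<^bsub>?R\<^esub> ?p"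
    then show "r \<in> {r \<in> carrier ?R. bc_snd r \<in> PIdl\<^bsub>ring_on A\<^esub> (bc_snd ?p)}"
      using A \<open>\<pi> \<in> A\<close> by (auto simp: cgenideal_def mem_bc_extension_iff cring_ring_on_iff)
  next
    fix r assume "r \<in> {r \<in> carrier ?R. bc_snd r \<in> PIdl\<^bsub>ring_on A\<^esub> (bc_snd ?p)}"
    then obtain x where "x \<in> A" "bc_snd r = x * \<pi>" "bc_fst r \<in> A"
      by (auto simp: cgenideal_def mem_bc_extension_iff)
    then show "r \<in> PIdl\<^bsub>?R\<^esub> ?p"
      unfolding cgenideal_def
      by (auto simp: mem_bc_extension_iff bc_coords_eq_iff
          intro!: exI[of _ "bc_of_complex (bc_fst r) * bc_e1 + bc_of_complex x * bc_e2"])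
  qed
  show "prime_element (ring_on A) (bc_snd ?p)"
    using prime by simp
qed

theorem mainTheorem3:
  fixes K :: "complex set" and L :: "bicomplex set" and \<pi> :: complex
  assumes "number_field K"
    and "L = bc_extension K"
    and "prime_element (ring_of_integers K) \<pi>"
  shows "semiprime (ring_of_integers L) (bc_of_complex \<pi>) \<and>
    bc_of_complex \<pi> =
      (bc_of_complex \<pi> * bc_e1 + bc_e2) * (bc_e1 + bc_of_complex \<pi> * bc_e2) \<and>
    prime_element (ring_of_integers L) (bc_of_complex \<pi> * bc_e1 + bc_e2) \<and>
    prime_element (ring_of_integers L) (bc_e1 + bc_of_complex \<pi> * bc_e2)"
proof -
  define A where "A = carrier (ring_of_integers K)"
  have "ring_of_integers K = ring_on A"
    by (simp add: A_def ring_of_integers_def)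
  with assms(3) have "prime_element (ring_on A) \<pi>" by simp
  note primes = prime_element_bc_extension_left[OF this] prime_element_bc_extension_right[OF this]
  have factors: "bc_of_complex \<pi> =
      (bc_of_complex \<pi> * bc_e1 + bc_e2) * (bc_e1 + bc_of_complex \<pi> * bc_e2)"
    by (simp add: bc_coords_eq_iff)
  with primes have "semiprime (ring_on (bc_extension A)) (bc_of_complex \<pi>)"
    unfolding semiprime_def ring_on_simps by blast
  moreover have "ring_of_integers L = ring_on (bc_extension A)"
    using assms(2) by (simp add: A_def ring_of_integers_bc_extension)
  ultimately show ?thesis
    using primes factors by simp
qed

end
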